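(* For any $\beta>1$ there exist constants $c_\beta,C_\beta>0$ depending only on $\beta$ such that the following holds for every integer $k\ge1$ and $p\in(0,1)$. Let $X=Y-kp$ with $Y\sim\mathrm{Bin}(k,p)$. Then (right tail) if $0\le x\le\frac{k(1-p)}{\beta}$ and $x+kp\ge1$, then $$\mathbb{P}(X\ge x)\ge c_\beta\exp\left(-C_\beta k\,h_p\left(p+\frac xk\right)\right);$$ if $0<kp+x<1$, then $\mathbb{P}(X\ge x)=1-(1-p)^k$; (left tail) if $0\le x\le\frac{kp}{\beta}$ and $x+k(1-p)\ge1$, then $$\mathbb{P}(X\le-x)\ge c_\beta\exp\left(-C_\beta k\,h_p\left(p-\frac xk\right)\right);$$ if $0<k(1-p)+x<1$, then $\mathbb{P}(X\le-x)=1-p^k$.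
   Context: $\mathrm{Bin}(k,p)$ is the binomial distribution with $k$ trials and success probability $p$. For $0<u,v<1$, $h_u(v)=v\log\left(\frac vu\right)+(1-v)\log\left(\frac{1-v}{1-u}\right)$ is the Kullback–Leibler divergence between the Bernoulli distributions with parameters $u$ and $v$. *)

theory Defs
  imports "HOL-Probability.Probability"
begin

text \<open>
  Kullback--Leibler divergence of the Bernoulli distribution with parameter \<open>v\<close> from the one with
  parameter \<open>u\<close>; meaningful for \<open>0 < u\<close>, \<open>u < 1\<close>, \<open>0 < v\<close>, \<open>v < 1\<close>.
\<close>
definition bern_kl :: "real \<Rightarrow> real \<Rightarrow> real" where
  "bern_kl u v = v * ln (v / u) + (1 - v) * ln ((1 - v) / (1 - u))"

text \<open>The law of \<open>X = Y - k p\<close> where \<open>Y\<close> has law \<open>Bin(k, p)\<close>.\<close>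
definition centered_binomial_pmf :: "nat \<Rightarrow> real \<Rightarrow> real pmf" where
  "centered_binomial_pmf k p = map_pmf (\<lambda>y. real y - real k * p) (binomial_pmf k p)"

end

theory Submission
  imports Defs
begin

text \<open>
  The proof is a change of measure. Put \<open>v = p + x / k\<close>, so that the right tail of \<open>X\<close> is the event
  \<open>A = {Y \<ge> k v}\<close>, and compare \<open>P = Bin(k, p)\<close> with the tilted law \<open>Q = Bin(k, v)\<close>, whose mean is
  exactly the threshold \<open>k v\<close>. The relative entropy of \<open>Q\<close> with respect to \<open>P\<close> is
  \<open>k h\<^sub>p(v)\<close> (lemma \<open>binomial_divergence\<close>), and an event that has probability at least \<open>q\<close> under \<open>Q\<close>
  has probability at least \<open>q exp (- (D + 1) / q)\<close> under any law relative to which the entropy of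
  \<open>Q\<close> is \<open>D\<close> (lemma \<open>event_prob_ge_exp_divergence\<close>). A constant factor in the exponent is
  allowed, so this loses nothing that matters as long as \<open>Q(A)\<close> is bounded below by an absolute
  constant.

  It remains to see that a binomial variable reaches its mean with probability bounded below
  (lemma \<open>binomial_prob_ge_mean\<close>). This is false when the mean is close to \<open>0\<close>, which is the
  role of the condition \<open>x + k p \<ge> 1\<close>. If the expected number \<open>k (1 - v)\<close> of failures is at most
  one half, then already \<open>Y = k\<close> has probability at least one half. Otherwise the variance
  is at least \<open>1/4\<close>, hence the fourth central moment is at most \<open>7\<close> times the squared variance,
  and a centred variable with such a fourth moment cannot put almost all of its mass on the
  negative side (lemma \<open>prob_nonneg_ge_of_moments\<close>).

  The left tail is the right tail of \<open>k - Y\<close>, which has law \<open>Bin(k, 1 - p)\<close>. When the threshold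
  lies strictly between \<open>0\<close> and \<open>1\<close>, the tail event says just that \<open>Y\<close> is nonzero.
\<close>

section \<open>A centred variable with controlled fourth moment is often nonnegative\<close>

text \<open>
  Take expectations in a polynomial minorant of the indicator of the half-line. The polynomial
  \<open>t / 6 + t\<^sup>2 / 8 - t\<^sup>4 / 96\<close> is nonpositive for negative \<open>t\<close>, where up to a constant factor it equals
  \<open>t (t + 2)\<^sup>2 (4 - t)\<close>, and is at most \<open>1\<close> elsewhere. Its linear term does not contribute to
  the expectation, and the scaling \<open>t = r f\<close> with \<open>r\<^sup>2 = 6 / (K V)\<close> makes the difference of the
  other two terms largest under the given bounds.
\<close>

lemma (in prob_space) prob_nonneg_ge_of_moments:
  fixes f :: "'a \<Rightarrow> real"
  assumes int: "integrable M f" "integrable M (\<lambda>x. f x ^ 2)" "integrable M (\<lambda>x. f x ^ 4)"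
    and mean: "expectation f = 0"
    and V: "V > 0" "expectation (\<lambda>x. f x ^ 2) = V"
    and K: "K > 0" "expectation (\<lambda>x. f x ^ 4) \<le> K * V\<^sup>2"
  shows "prob {x \<in> space M. f x \<ge> 0} \<ge> 3 / (8 * K)"
proof -
  have minorant: "t / 6 + t ^ 2 / 8 - t ^ 4 / 96 \<le> indicator {0..} t" for t :: real
  proof (cases "t \<ge> 0")
    case True
    have "0 \<le> ((t\<^sup>2 - 8)\<^sup>2 + 4 * (t - 2)\<^sup>2 + 16) / 96"
      by (intro divide_nonneg_nonneg add_nonneg_nonneg mult_nonneg_nonneg) auto
    also have "\<dots> = 1 - (t / 6 + t ^ 2 / 8 - t ^ 4 / 96)"
      by (simp add: field_simps power2_eq_square power4_eq_xxxx)
    finally show ?thesis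
      using True by simp
  next
    case False
    have "0 \<le> (- t) * ((- t) - 2)\<^sup>2 * ((- t) + 4) / 96"
      using False by (intro divide_nonneg_nonneg mult_nonneg_nonneg) auto
    also have "\<dots> = - (t / 6 + t ^ 2 / 8 - t ^ 4 / 96)"
      by (simp add: field_simps power2_eq_square power4_eq_xxxx)
    finally show ?thesis
      using False by simp
  qed
  define r where "r = sqrt (6 / (K * V))"
  have r2: "r ^ 2 = 6 / (K * V)" and "r > 0"
    using V(1) K(1) by (auto simp: r_def)
  have r4: "r ^ 4 = 36 / (K\<^sup>2 * V\<^sup>2)"
    using arg_cong[OF r2, of "\<lambda>z. z ^ 2"] by (simp add: power_divide power_mult_distrib flip: power_mult)
  have [measurable]: "f \<in> borel_measurable M"
    using int(1) by auto
  have "3 / (8 * K) = r ^ 2 * V / 8 - r ^ 4 * (K * V\<^sup>2) / 96"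
    using V(1) K(1) unfolding r2 r4 by (simp add: field_simps power2_eq_square)
  also have "\<dots> \<le> r * expectation f / 6 + r ^ 2 * expectation (\<lambda>x. f x ^ 2) / 8
      - r ^ 4 * expectation (\<lambda>x. f x ^ 4) / 96"
    using mean V(2) mult_left_mono[OF K(2), of "r ^ 4"] by simp
  also have "\<dots> = expectation (\<lambda>x. (r * f x) / 6 + (r * f x) ^ 2 / 8 - (r * f x) ^ 4 / 96)"
    using int by (simp add: power_mult_distrib)
  also have "\<dots> \<le> expectation (indicator {x \<in> space M. f x \<ge> 0})"
  proof (rule integral_mono)
    fix x assume "x \<in> space M"
    then show "(r * f x) / 6 + (r * f x) ^ 2 / 8 - (r * f x) ^ 4 / 96
        \<le> indicator {x \<in> space M. f x \<ge> 0} x"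
      using minorant[of "r * f x"] \<open>r > 0\<close>
      by (auto simp: indicator_def zero_le_mult_iff split: if_splits)
  next
    show "integrable M (indicator {x \<in> space M. f x \<ge> 0} :: 'a \<Rightarrow> real)"
      by (intro integrable_real_indicator) (auto simp: emeasure_eq_measure)
  qed (use int in \<open>auto simp: power_mult_distrib\<close>)
  also have "\<dots> = prob {x \<in> space M. f x \<ge> 0}"
    by simp
  finally show ?thesis .
qed

section \<open>A binomial variable reaches its mean with probability bounded below\<close>

lemma expectation_binomial_pmf_Suc:
  fixes h :: "nat \<Rightarrow> real"
  assumes "v \<in> {0..1}"
  shows "measure_pmf.expectation (binomial_pmf (Suc n) v) h
    = v * measure_pmf.expectation (binomial_pmf n v) (\<lambda>i. h (Suc i))
      + (1 - v) * measure_pmf.expectation (binomial_pmf n v) h"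
proof -
  have fin: "finite (set_pmf (binomial_pmf n v))"
    using assms by (auto simp: set_pmf_binomial_eq)
  show ?thesis
    unfolding binomial_pmf_Suc[OF assms] map_pmf_def[symmetric]
    using assms fin by (subst pmf_expectation_bind[where A = UNIV]) (auto simp: UNIV_bool)
qed

text \<open>
  Induction on the number of trials: one further trial adds an independent centred variable with
  variance \<open>s\<close> and fourth moment \<open>s (1 - 3 s)\<close>. The odd cross terms vanish because both
  summands are centred, so that the third moment never has to be known.
\<close>
lemma binomial_central_moments:
  fixes v :: real
  assumes "v \<in> {0..1}"
  defines "s \<equiv> v * (1 - v)"
  shows "measure_pmf.expectation (binomial_pmf n v) (\<lambda>i. real i - real n * v) = 0"
    and "measure_pmf.expectation (binomial_pmf n v) (\<lambda>i. (real i - real n * v) ^ 2) = real n * s"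
    and "measure_pmf.expectation (binomial_pmf n v) (\<lambda>i. (real i - real n * v) ^ 4)
      = 3 * (real n * s)\<^sup>2 + real n * s * (1 - 6 * s)"
proof -
  let ?E = "\<lambda>n. measure_pmf.expectation (binomial_pmf n v)"
  let ?Z = "\<lambda>n i. real i - real n * v"
  have step: "?E (Suc n) (\<lambda>i. ?Z (Suc n) i ^ m)
      = v * ?E n (\<lambda>i. (?Z n i + (1 - v)) ^ m) + (1 - v) * ?E n (\<lambda>i. (?Z n i + (- v)) ^ m)" for n m
    by (subst expectation_binomial_pmf_Suc[OF assms(1)]) (simp add: algebra_simps)
  note [simp] = integrable_binomial_pmf[OF assms(1)]
  have shift2: "?E n (\<lambda>i. (?Z n i + a) ^ 2) = ?E n (\<lambda>i. ?Z n i ^ 2) + 2 * a * ?E n (?Z n) + a ^ 2" for n a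
    by (simp add: power2_sum)
  have shift4: "?E n (\<lambda>i. (?Z n i + a) ^ 4) = ?E n (\<lambda>i. ?Z n i ^ 4) + 4 * a * ?E n (\<lambda>i. ?Z n i ^ 3)
      + 6 * a ^ 2 * ?E n (\<lambda>i. ?Z n i ^ 2) + 4 * a ^ 3 * ?E n (?Z n) + a ^ 4" for n a
  proof -
    have *: "(z + a) ^ 4 = z ^ 4 + 4 * a * z ^ 3 + 6 * a ^ 2 * z ^ 2 + 4 * a ^ 3 * z + a ^ 4" for z
      by algebra
    show ?thesis unfolding * by simp
  qed
  have "?E n (?Z n) = 0 \<and> ?E n (\<lambda>i. ?Z n i ^ 2) = real n * s
      \<and> ?E n (\<lambda>i. ?Z n i ^ 4) = 3 * (real n * s)\<^sup>2 + real n * s * (1 - 6 * s)"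
  proof (induction n)
    case 0
    then show ?case using assms by (simp add: binomial_pmf_0)
  next
    case (Suc n)
    then have IH: "?E n (?Z n) = 0" "?E n (\<lambda>i. ?Z n i ^ 2) = real n * s"
      "?E n (\<lambda>i. ?Z n i ^ 4) = 3 * (real n * s)\<^sup>2 + real n * s * (1 - 6 * s)"
      by auto
    have m1: "?E (Suc n) (?Z (Suc n)) = 0"
      using step[of n 1] IH(1) by (simp add: algebra_simps)
    have m2: "?E (Suc n) (\<lambda>i. ?Z (Suc n) i ^ 2) = real (Suc n) * s"
      unfolding step shift2 IH by (simp add: s_def algebra_simps power2_eq_square)
    have m4: "?E (Suc n) (\<lambda>i. ?Z (Suc n) i ^ 4)
        = 3 * (real (Suc n) * s)\<^sup>2 + real (Suc n) * s * (1 - 6 * s)"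
    proof -
      have "?E (Suc n) (\<lambda>i. ?Z (Suc n) i ^ 4) =
         3 * (real n * s)\<^sup>2 + real n * s * (1 - 6 * s) + 6 * s * (real n * s)
           + (v * (1 - v) ^ 4 + (1 - v) * v ^ 4)"
        unfolding step shift4 IH by (simp add: s_def) algebra
      also have "\<dots> = 3 * ((real n + 1) * s)\<^sup>2 + (real n + 1) * s * (1 - 6 * s)"
        unfolding s_def by algebra
      finally show ?thesis by (simp add: add.commute)
    qed
    show ?case using m1 m2 m4 by blast
  qed
  then show "?E n (?Z n) = 0" "?E n (\<lambda>i. ?Z n i ^ 2) = real n * s"
    "?E n (\<lambda>i. ?Z n i ^ 4) = 3 * (real n * s)\<^sup>2 + real n * s * (1 - 6 * s)"
    by auto
qed

text \<open>
  The moment method works only when the variance is bounded away from \<open>0\<close>. Since the mean is at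
  least \<open>1\<close>, this fails only when \<open>v\<close> is so near \<open>1\<close> that few failures are expected, and then the
  event that all trials succeed is likely.
\<close>
lemma binomial_prob_ge_mean:
  fixes k :: nat and v :: real
  assumes "real k * v \<ge> 1" "v < 1"
  shows "measure_pmf.prob (binomial_pmf k v) {i. real i \<ge> real k * v} \<ge> 1 / 20"
proof -
  have "k > 0" using assms by (cases k) auto
  then have v: "0 < v" using assms(1) by (smt (verit) mult_nonneg_nonpos of_nat_0_le_iff)
  have v01: "v \<in> {0..1}" using v assms by auto
  show ?thesis
  proof (cases "real k * (1 - v) \<le> 1 / 2")
    case True
    have "1 / 20 \<le> 1 + real k * (v - 1)"
      using True by (simp add: algebra_simps)
    also have "\<dots> \<le> v ^ k"
      using Bernoulli_inequality[of "v - 1" k] v by simp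
    also have "\<dots> = measure_pmf.prob (binomial_pmf k v) {k}"
      using v01 by (simp add: measure_pmf_single)
    also have "\<dots> \<le> measure_pmf.prob (binomial_pmf k v) {i. real i \<ge> real k * v}"
      using assms by (intro measure_pmf.finite_measure_mono) (auto simp: mult_left_le)
    finally show ?thesis .
  next
    case False
    define V where "V = real k * (v * (1 - v))"
    have V: "V \<ge> 1 / 4"
    proof (cases "v \<ge> 1 / 2")
      case True
      have "1 / 2 * (1 / 2) \<le> v * (real k * (1 - v))"
        using True False by (intro mult_mono) auto
      then show ?thesis by (simp add: V_def algebra_simps)
    next
      case False
      have "1 * (1 / 2) \<le> (real k * v) * (1 - v)"
        using False assms by (intro mult_mono) auto
      then show ?thesis by (simp add: V_def algebra_simps)
    qed
    have "V * (1 - 6 * (v * (1 - v))) \<le> V * 1"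
      using V v assms by (intro mult_left_mono) auto
    also have "\<dots> \<le> 4 * V\<^sup>2"
      using V mult_right_mono[of 1 "4 * V" V] by (simp add: power2_eq_square)
    \<comment> \<open>The term linear in \<open>V\<close> is absorbed by \<open>V \<le> 4 V\<^sup>2\<close>, which is where \<open>V \<ge> 1 / 4\<close> enters.\<close>
    finally have fourth: "3 * V\<^sup>2 + V * (1 - 6 * (v * (1 - v))) \<le> 7 * V\<^sup>2"
      by simp
    have "3 / (8 * 7) \<le> measure_pmf.prob (binomial_pmf k v)
        {i \<in> space (binomial_pmf k v). real i - real k * v \<ge> 0}"
      by (rule measure_pmf.prob_nonneg_ge_of_moments[where V = V])
        (use V fourth v01 binomial_central_moments[OF v01, of k] in
          \<open>auto simp: V_def intro!: integrable_binomial_pmf\<close>)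
    then show ?thesis by simp
  qed
qed

section \<open>Change of measure\<close>

text \<open>
  Write \<open>P = Q exp (- L)\<close> with the log-likelihood ratio \<open>L\<close>, whose sum weighted by \<open>Q\<close> is \<open>D\<close>.
  The part of this sum outside \<open>A\<close> cannot be below \<open>- 1\<close>, because \<open>- L \<le> exp (- L)\<close> and \<open>Q exp (- L) = P\<close>
  has mass at most \<open>1\<close>; hence \<open>L\<close> contributes at most \<open>D + 1\<close> on \<open>A\<close>. Jensen's
  inequality for the exponential on \<open>A\<close> then gives the bound; it is applied in the form of the
  tangent line at \<open>l = (D + 1) / q\<close>, an upper bound for the \<open>Q\<close>-average of \<open>L\<close> over \<open>A\<close>.
\<close>
lemma event_prob_ge_exp_divergence:
  fixes P Q :: "'a \<Rightarrow> real"
  assumes "finite S" "A \<subseteq> S"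
    and pos: "\<And>i. i \<in> S \<Longrightarrow> P i > 0" "\<And>i. i \<in> S \<Longrightarrow> Q i > 0"
    and total: "(\<Sum>i\<in>S. P i) \<le> 1"
    and q: "0 < q" "q \<le> (\<Sum>i\<in>A. Q i)"
    and D: "D \<ge> 0" "D = (\<Sum>i\<in>S. Q i * ln (Q i / P i))"
  shows "(\<Sum>i\<in>A. P i) \<ge> q * exp (- ((D + 1) / q))"
proof -
  define L where "L i = ln (Q i / P i)" for i
  define l where "l = (D + 1) / q"
  have l: "l \<ge> 0" "q * l = D + 1"
    using q D by (auto simp: l_def)
  have P: "P i = Q i * exp (- L i)" if "i \<in> S" for i
    using pos[OF that] by (simp add: L_def exp_minus)
  have "- 1 \<le> (\<Sum>i\<in>S - A. Q i * L i)"
  proof -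
    have "- 1 \<le> (\<Sum>i\<in>S - A. - P i)"
      using total pos(1) sum_mono2[OF \<open>finite S\<close>, of "S - A" P]
      by (fastforce simp: sum_negf less_imp_le)
    also have "\<dots> \<le> (\<Sum>i\<in>S - A. Q i * L i)"
    proof (rule sum_mono)
      fix i assume i: "i \<in> S - A"
      have "- L i \<le> exp (- L i)" using exp_ge_add_one_self[of "- L i"] by linarith
      then have "Q i * (- L i) \<le> Q i * exp (- L i)"
        using pos(2)[of i] i by (intro mult_left_mono) auto
      then show "- P i \<le> Q i * L i" using P i by simp
    qed
    finally show ?thesis .
  qed
  moreover have "D = (\<Sum>i\<in>S - A. Q i * L i) + (\<Sum>i\<in>A. Q i * L i)"
    unfolding D(2) L_def using assms(1,2) by (rule sum.subset_diff[rotated])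
  ultimately have LA: "(\<Sum>i\<in>A. Q i * L i) \<le> D + 1"
    by linarith
  have "q = q * (1 + l) - (D + 1)"
    using l by (simp add: algebra_simps)
  also have "\<dots> \<le> (\<Sum>i\<in>A. Q i) * (1 + l) - (\<Sum>i\<in>A. Q i * L i)"
    using LA q(2) l(1) by (intro diff_mono mult_right_mono) auto
  also have "\<dots> = (\<Sum>i\<in>A. Q i * (1 + (l - L i)))"
    by (simp add: algebra_simps sum.distrib sum_subtractf sum_distrib_left)
  also have "\<dots> \<le> (\<Sum>i\<in>A. Q i * exp (l - L i))"
    using assms(2) pos(2) by (intro sum_mono mult_left_mono exp_ge_add_one_self) (auto simp: less_imp_le)
  also have "\<dots> = exp l * (\<Sum>i\<in>A. P i)"
    using assms(2) P unfolding sum_distrib_left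
    by (intro sum.cong) (auto simp: exp_diff exp_minus field_simps)
  finally show ?thesis
    by (simp add: l_def exp_minus field_simps)
qed

text \<open>Each of the two terms is bounded below by \<open>b ln (b / a) \<ge> b - a\<close>, and these bounds cancel.\<close>
lemma bern_kl_nonneg:
  assumes "0 < u" "u < 1" "0 < v" "v < 1"
  shows "bern_kl u v \<ge> 0"
proof -
  have *: "b - a \<le> b * ln (b / a)" if "a > 0" "b > 0" for a b :: real
  proof -
    have "b * ln (a / b) \<le> b * (a / b - 1)"
      using that ln_le_minus_one[of "a / b"] by (intro mult_left_mono) auto
    then show ?thesis using that by (simp add: ln_div algebra_simps)
  qed
  show ?thesis
    using *[of u v] *[of "1 - u" "1 - v"] assms by (simp add: bern_kl_def)
qed

text \<open>
  The log-likelihood ratio of two binomial laws is affine in the number of successes, with value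
  \<open>k h\<^sub>u(v)\<close> at the mean \<open>k v\<close> of the first law.
\<close>
lemma binomial_divergence:
  assumes "0 < u" "u < 1" "0 < v" "v < 1"
  shows "(\<Sum>i\<le>k. pmf (binomial_pmf k v) i * ln (pmf (binomial_pmf k v) i / pmf (binomial_pmf k u) i))
    = real k * bern_kl u v"
proof -
  let ?a = "ln (v / u)" and ?b = "ln ((1 - v) / (1 - u))"
  have v01: "v \<in> {0..1}" using assms by auto
  note [simp] = integrable_binomial_pmf[OF v01]
  have lr: "ln (pmf (binomial_pmf k v) i / pmf (binomial_pmf k u) i)
      = (real i - real k * v) * (?a - ?b) + real k * bern_kl u v" if "i \<le> k" for i
  proof -
    have "pmf (binomial_pmf k v) i / pmf (binomial_pmf k u) i
        = (v / u) ^ i * ((1 - v) / (1 - u)) ^ (k - i)"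
      using assms that by (simp add: power_divide)
    then have "ln (pmf (binomial_pmf k v) i / pmf (binomial_pmf k u) i)
        = real i * ?a + real (k - i) * ?b"
      using assms by (simp add: ln_mult ln_realpow)
    then show ?thesis
      using that by (simp add: bern_kl_def of_nat_diff algebra_simps)
  qed
  have "(\<Sum>i\<le>k. pmf (binomial_pmf k v) i * ln (pmf (binomial_pmf k v) i / pmf (binomial_pmf k u) i))
      = measure_pmf.expectation (binomial_pmf k v)
          (\<lambda>i. (real i - real k * v) * (?a - ?b) + real k * bern_kl u v)"
    using lr v01 by (subst expectation_binomial_pmf') (auto intro!: sum.cong)
  also have "\<dots> = real k * bern_kl u v"
    using binomial_central_moments(1)[OF v01, of k] by simp
  finally show ?thesis .
qed

text \<open>
  The constants come from \<open>event_prob_ge_exp_divergence\<close> with \<open>q = 1 / 20\<close>, the lower bound of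
  \<open>binomial_prob_ge_mean\<close> for the law tilted to have its mean at the threshold.
\<close>
lemma binomial_upper_tail_ge:
  fixes k :: nat and p v :: real
  assumes "0 < p" "p < 1" "v < 1" "real k * v \<ge> 1"
  shows "measure_pmf.prob (binomial_pmf k p) {i. real i \<ge> real k * v}
    \<ge> exp (- 20) / 20 * exp (- 20 * real k * bern_kl p v)"
proof -
  have v: "0 < v" using assms(4) by (smt (verit) mult_nonneg_nonpos of_nat_0_le_iff)
  let ?A = "{i. i \<le> k \<and> real i \<ge> real k * v}"
  have prob: "measure_pmf.prob (binomial_pmf k w) {i. real i \<ge> real k * v}
      = (\<Sum>i\<in>?A. pmf (binomial_pmf k w) i)" if "0 < w" "w < 1" for w
  proof -
    have "measure_pmf.prob (binomial_pmf k w) {i. real i \<ge> real k * v}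
        = measure_pmf.prob (binomial_pmf k w) ?A"
      using that by (intro measure_pmf.finite_measure_eq_AE) (auto simp: AE_measure_pmf_iff set_pmf_binomial_eq)
    then show ?thesis by (simp add: measure_measure_pmf_finite)
  qed
  have "1 / 20 * exp (- ((real k * bern_kl p v + 1) / (1 / 20)))
      \<le> (\<Sum>i\<in>?A. pmf (binomial_pmf k p) i)"
  proof (rule event_prob_ge_exp_divergence[where S = "{..k}"])
    show "(\<Sum>i\<le>k. pmf (binomial_pmf k p) i) \<le> 1"
      using measure_pmf.prob_le_1[of "binomial_pmf k p" "{..k}"]
      by (simp add: measure_measure_pmf_finite)
    show "1 / 20 \<le> (\<Sum>i\<in>?A. pmf (binomial_pmf k v) i)"
      using binomial_prob_ge_mean[OF assms(4,3)] prob[OF v assms(3)] by simp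
    show "real k * bern_kl p v = (\<Sum>i\<le>k. pmf (binomial_pmf k v) i *
        ln (pmf (binomial_pmf k v) i / pmf (binomial_pmf k p) i))"
      using binomial_divergence[of p v k] assms v by simp
    show "0 \<le> real k * bern_kl p v"
      using bern_kl_nonneg[of p v] assms v by simp
  qed (use assms v in auto)
  moreover have "1 / 20 * exp (- ((real k * bern_kl p v + 1) / (1 / 20)))
      = exp (- 20) / 20 * exp (- 20 * real k * bern_kl p v)"
    by (simp add: algebra_simps flip: exp_add)
  ultimately show ?thesis
    using prob[OF assms(1,2)] by simp
qed

section \<open>Both tails of the centred binomial law\<close>

lemma prob_centered_binomial_ge:
  assumes "k \<ge> 1"
  shows "measure_pmf.prob (centered_binomial_pmf k p) {t. t \<ge> x}
    = measure_pmf.prob (binomial_pmf k p) {i. real i \<ge> real k * (p + x / real k)}"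
proof -
  have "(\<lambda>y. real y - real k * p) -` {t. t \<ge> x} = {i. real i \<ge> real k * (p + x / real k)}"
    using assms by (auto simp: distrib_left)
  then show ?thesis
    by (simp add: centered_binomial_pmf_def measure_map_pmf)
qed

lemma binomial_pmf_reflect:
  assumes "p \<in> {0..1}"
  shows "map_pmf (\<lambda>i. k - i) (binomial_pmf k p) = binomial_pmf k (1 - p)"
proof (rule pmf_eqI)
  fix j
  show "pmf (map_pmf (\<lambda>i. k - i) (binomial_pmf k p)) j = pmf (binomial_pmf k (1 - p)) j"
  proof (cases "j \<le> k")
    case True
    have "pmf (map_pmf (\<lambda>i. k - i) (binomial_pmf k p)) j
        = measure_pmf.prob (binomial_pmf k p) ((\<lambda>i. k - i) -` {j})"
      by (simp add: pmf_map)
    also have "\<dots> = measure_pmf.prob (binomial_pmf k p) {k - j}"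
      using assms True by (intro measure_pmf.finite_measure_eq_AE)
        (auto simp: AE_measure_pmf_iff set_pmf_binomial_eq)
    also have "\<dots> = pmf (binomial_pmf k (1 - p)) j"
      using assms True by (simp add: measure_pmf_single binomial_symmetric[symmetric])
    finally show ?thesis .
  next
    case False
    then show ?thesis using assms
      by (subst (1 2) pmf_eq_0_set_pmf[THEN iffD2]) (auto simp: set_pmf_binomial_eq split: if_splits)
  qed
qed

lemma centered_binomial_pmf_reflect:
  assumes "p \<in> {0..1}"
  shows "map_pmf uminus (centered_binomial_pmf k p) = centered_binomial_pmf k (1 - p)"
proof -
  have "centered_binomial_pmf k (1 - p)
      = map_pmf (\<lambda>i. real (k - i) - real k * (1 - p)) (binomial_pmf k p)"
    unfolding centered_binomial_pmf_def binomial_pmf_reflect[OF assms, symmetric]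
    by (simp add: pmf.map_comp o_def)
  also have "\<dots> = map_pmf uminus (centered_binomial_pmf k p)"
    unfolding centered_binomial_pmf_def pmf.map_comp using assms
    by (intro map_pmf_cong refl)
      (auto simp: set_pmf_binomial_eq of_nat_diff algebra_simps split: if_splits)
  finally show ?thesis ..
qed

lemma prob_centered_binomial_le:
  assumes "p \<in> {0..1}"
  shows "measure_pmf.prob (centered_binomial_pmf k p) {t. t \<le> - x}
    = measure_pmf.prob (centered_binomial_pmf k (1 - p)) {t. t \<ge> x}"
proof -
  have "uminus -` {t. t \<ge> x} = {t. t \<le> - x}" by auto
  then show ?thesis
    by (simp add: measure_map_pmf flip: centered_binomial_pmf_reflect[OF assms])
qed

lemma bern_kl_reflect: "bern_kl (1 - u) (1 - v) = bern_kl u v"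
  by (simp add: bern_kl_def)

text \<open>
  The upper bound on \<open>x\<close> keeps the tilted parameter \<open>p + x / k\<close> below \<open>1\<close>, and \<open>x + k p \<ge> 1\<close> makes
  the mean of the tilted law at least \<open>1\<close>.
\<close>
lemma centered_binomial_upper_tail_ge:
  assumes "k \<ge> 1" "0 < p" "p < 1" "\<beta> > 1" "0 \<le> x" "x \<le> real k * (1 - p) / \<beta>" "x + real k * p \<ge> 1"
  shows "measure_pmf.prob (centered_binomial_pmf k p) {t. t \<ge> x}
    \<ge> exp (- 20) / 20 * exp (- 20 * real k * bern_kl p (p + x / real k))"
proof -
  have "real k * (1 - p) / \<beta> < real k * (1 - p)"
    using assms by (simp add: divide_less_eq)
  then have "x < real k * (1 - p)" using assms(6) by linarith
  then have "p + x / real k < 1" using assms(1) by (simp add: field_simps)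
  moreover have "real k * (p + x / real k) \<ge> 1" using assms by (simp add: distrib_left)
  ultimately show ?thesis
    unfolding prob_centered_binomial_ge[OF assms(1)]
    using assms by (intro binomial_upper_tail_ge) auto
qed

lemma centered_binomial_prob_ge_eq:
  assumes "k \<ge> 1" "0 < p" "p < 1" "0 < real k * p + x" "real k * p + x < 1"
  shows "measure_pmf.prob (centered_binomial_pmf k p) {t. t \<ge> x} = 1 - (1 - p) ^ k"
proof -
  have "{i. real i \<ge> real k * (p + x / real k)} = UNIV - {0::nat}"
  proof -
    have "real i \<ge> real k * p + x \<longleftrightarrow> i \<noteq> 0" for i :: nat
      using assms by (cases i) auto
    then show ?thesis using assms(1) by (auto simp: distrib_left)
  qed
  then show ?thesis
    unfolding prob_centered_binomial_ge[OF assms(1)]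
    using assms measure_pmf.prob_compl[of "{0}" "binomial_pmf k p"]
    by (simp add: measure_pmf_single)
qed

theorem theorem9:
  fixes \<beta> :: real
  assumes "\<beta> > 1"
  shows "\<exists>c C :: real. c > 0 \<and> C > 0 \<and>
    (\<forall>(k :: nat) (p :: real). k \<ge> 1 \<longrightarrow> 0 < p \<longrightarrow> p < 1 \<longrightarrow>
      (\<forall>x :: real. 0 \<le> x \<longrightarrow> x \<le> real k * (1 - p) / \<beta> \<longrightarrow> x + real k * p \<ge> 1 \<longrightarrow>
        measure_pmf.prob (centered_binomial_pmf k p) {t. t \<ge> x}
          \<ge> c * exp (- C * real k * bern_kl p (p + x / real k))) \<and>
      (\<forall>x :: real. 0 < real k * p + x \<longrightarrow> real k * p + x < 1 \<longrightarrow>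
        measure_pmf.prob (centered_binomial_pmf k p) {t. t \<ge> x} = 1 - (1 - p) ^ k) \<and>
      (\<forall>x :: real. 0 \<le> x \<longrightarrow> x \<le> real k * p / \<beta> \<longrightarrow> x + real k * (1 - p) \<ge> 1 \<longrightarrow>
        measure_pmf.prob (centered_binomial_pmf k p) {t. t \<le> - x}
          \<ge> c * exp (- C * real k * bern_kl p (p - x / real k))) \<and>
      (\<forall>x :: real. 0 < real k * (1 - p) + x \<longrightarrow> real k * (1 - p) + x < 1 \<longrightarrow>
        measure_pmf.prob (centered_binomial_pmf k p) {t. t \<le> - x} = 1 - p ^ k))"
proof (rule exI[of _ "exp (- 20) / 20"], rule exI[of _ 20], intro conjI allI impI)
  fix k :: nat and p x :: real
  assume k: "k \<ge> 1" and p: "0 < p" "p < 1"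
  have p01: "p \<in> {0..1}" using p by simp
  {
    assume "0 \<le> x" "x \<le> real k * (1 - p) / \<beta>" "x + real k * p \<ge> 1"
    then show "measure_pmf.prob (centered_binomial_pmf k p) {t. t \<ge> x}
        \<ge> exp (- 20) / 20 * exp (- 20 * real k * bern_kl p (p + x / real k))"
      using k p assms by (intro centered_binomial_upper_tail_ge)
  next
    assume "0 < real k * p + x" "real k * p + x < 1"
    then show "measure_pmf.prob (centered_binomial_pmf k p) {t. t \<ge> x} = 1 - (1 - p) ^ k"
      using k p by (intro centered_binomial_prob_ge_eq)
  next
    assume "0 \<le> x" "x \<le> real k * p / \<beta>" "x + real k * (1 - p) \<ge> 1"
    then show "measure_pmf.prob (centered_binomial_pmf k p) {t. t \<le> - x}
        \<ge> exp (- 20) / 20 * exp (- 20 * real k * bern_kl p (p - x / real k))"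
      using centered_binomial_upper_tail_ge[of k "1 - p" \<beta> x] k p assms
        bern_kl_reflect[of p "p - x / real k"]
      by (simp add: prob_centered_binomial_le[OF p01] algebra_simps)
  next
    assume "0 < real k * (1 - p) + x" "real k * (1 - p) + x < 1"
    then show "measure_pmf.prob (centered_binomial_pmf k p) {t. t \<le> - x} = 1 - p ^ k"
      using centered_binomial_prob_ge_eq[of k "1 - p" x] k p
      by (simp add: prob_centered_binomial_le[OF p01])
  }
qed auto

end
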